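(* For any $k\geq0$, let $H_k$ be the $k$-th Hilbert polynomial $$H_k(X)=\frac{X(X-1)\cdots(X-k+1)}{k!}.$$ Consider the linear map $H:\mathrm{QSym}\to\mathbb{Q}[X]$ sending $M_{u_1,\ldots,u_k}$ to $H_k$, for every composition $(u_1,\ldots,u_k)$. Then $H$ is the unique morphism from $\mathrm{QSym}$ to $\mathbb{Q}[X]$ compatible with $m$, $\Delta$ and $\delta$, i.e. the unique map which is both a Hopf algebra morphism from $(\mathrm{QSym},m,\Delta)$ to $(\mathbb{Q}[X],m,\Delta)$ and a bialgebra morphism from $(\mathrm{QSym},m,\delta)$ to $(\mathbb{Q}[X],m,\delta)$.
   Context: $\mathrm{QSym}$ is the $\mathbb{Q}$-vector space with basis $(M_u)$ indexed by compositions $u$ (finite, possibly empty, sequences of positive integers). Its product $m$ is the quasi-shuffle product, i.e. the product such that, for an infinite totally ordered alphabet $\mathbf{X}$ of commuting variables, the linear map $M_{u_1,\ldots,u_n}\mapsto\sum_{x_1<\cdots<x_n\text{ in }\mathbf{X}}x_1^{u_1}\cdots x_n^{u_n}$ is an (injective) algebra morphism to formal power series; the unit is $M_\emptyset=1$. The coproduct $\Delta$ is deconcatenation: $\Delta(M_w)=\sum_{uv=w}M_u\otimes M_v$ (sum over all factorizations of $w$ as a concatenation, possibly with empty factors). $(\mathrm{QSym},m,\Delta)$ is a Hopf algebra. The second coproduct $\delta$ is given, for $w$ a composition of length $n\geq1$, by $$\delta(M_w)=\sum_{k=1}^n\ \sum_{w=w_1\cdots w_k}M_{|w_1|,\ldots,|w_k|}\otimes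 M_{w_1}\cdots M_{w_k},$$ where the inner sum is over factorizations of $w$ into $k$ nonempty compositions, $|w_i|$ is the sum of the letters of $w_i$, and the right factor uses the product of $\mathrm{QSym}$; $\delta(1)=1\otimes1$. $(\mathrm{QSym},m,\delta)$ is a bialgebra, whose counit $\varepsilon'$ sends $M_u$ to $1$ if $u$ has at most one letter, and to $0$ otherwise. On $\mathbb{Q}[X]$, $m$ is the usual product, and $\Delta$, $\delta$ are the algebra morphisms with $\Delta(X)=X\otimes1+1\otimes X$ and $\delta(X)=X\otimes X$; their counits are $P\mapsto P(0)$ and $P\mapsto P(1)$. Bialgebra morphisms preserve units and counits. *)

theory Defs
  imports
    Complex_Main
    "HOL-Library.Poly_Mapping"
    "HOL-Library.Product_Plus"
    "HOL-Computational_Algebra.Polynomial"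
begin

section \<open>Rational vector spaces with a basis\<close>

text \<open>
  The rational vector space with basis indexed by a type \<open>'b\<close> is the type \<open>'b \<Rightarrow>\<^sub>0 rat\<close> of finitely
  supported functions. The tensor product of two spaces with bases indexed by \<open>'b\<close> and \<open>'c\<close> is the
  space with basis indexed by \<open>'b \<times> 'c\<close>.
\<close>

definition fscale :: "rat \<Rightarrow> ('b \<Rightarrow>\<^sub>0 rat) \<Rightarrow> ('b \<Rightarrow>\<^sub>0 rat)" where
  "fscale c x = Poly_Mapping.map ((*) c) x"

lemma lookup_fscale [simp]: "Poly_Mapping.lookup (fscale c x) b = c * Poly_Mapping.lookup x b"
  by (simp add: fscale_def Poly_Mapping.map.rep_eq when_def)

lemma vector_space_fscale: "vector_space fscale"
  by unfold_locales (rule poly_mapping_eqI; simp add: lookup_add algebra_simps)+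

lemma vector_space_smult_poly: "vector_space (smult :: rat \<Rightarrow> rat poly \<Rightarrow> rat poly)"
  by unfold_locales (simp_all add: smult_add_left smult_add_right)

text \<open>The linear extension of a map \<open>g\<close> defined on the basis; \<open>s\<close> is the scalar multiplication
  of the target.\<close>

definition lin_ext :: "(rat \<Rightarrow> 'v \<Rightarrow> 'v::comm_monoid_add) \<Rightarrow> ('b \<Rightarrow> 'v) \<Rightarrow> ('b \<Rightarrow>\<^sub>0 rat) \<Rightarrow> 'v" where
  "lin_ext s g x = (\<Sum>b\<in>Poly_Mapping.keys x. s (Poly_Mapping.lookup x b) (g b))"

definition ftensor :: "('b \<Rightarrow>\<^sub>0 rat) \<Rightarrow> ('c \<Rightarrow>\<^sub>0 rat) \<Rightarrow> ('b \<times> 'c \<Rightarrow>\<^sub>0 rat)" (infixl \<open>\<otimes>\<close> 75) where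
  "x \<otimes> y = (\<Sum>b\<in>Poly_Mapping.keys x. \<Sum>c\<in>Poly_Mapping.keys y.
      Poly_Mapping.single (b, c) (Poly_Mapping.lookup x b * Poly_Mapping.lookup y c))"


section \<open>Compositions and quasisymmetric functions\<close>

typedef posnat = "{n::nat. 0 < n}"
  by auto

setup_lifting type_definition_posnat

instantiation posnat :: ab_semigroup_add
begin

lift_definition plus_posnat :: "posnat \<Rightarrow> posnat \<Rightarrow> posnat" is "(+)"
  by simp

instance
  by standard (transfer; simp)+

end

type_synonym composition = "posnat list"

type_synonym qsym = "composition \<Rightarrow>\<^sub>0 rat"

definition M :: "composition \<Rightarrow> qsym" where
  "M u = Poly_Mapping.single u 1"

text \<open>The weight $|w|$; it is only meaningful (and only used) for nonempty \<open>w\<close>.\<close>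

definition weight :: "composition \<Rightarrow> posnat" where
  "weight w = Abs_posnat (\<Sum>a\<leftarrow>w. Rep_posnat a)"

text \<open>The terms, with multiplicity, of the quasi-shuffle of two words.\<close>

fun quasi_shuffles :: "'l::plus list \<Rightarrow> 'l list \<Rightarrow> 'l list list" where
  "quasi_shuffles [] v = [v]"
| "quasi_shuffles (a # u) [] = [a # u]"
| "quasi_shuffles (a # u) (b # v) =
     map ((#) a) (quasi_shuffles u (b # v)) @
     map ((#) b) (quasi_shuffles (a # u) v) @
     map ((#) (a + b)) (quasi_shuffles u v)"

definition qsym_mult :: "qsym \<Rightarrow> qsym \<Rightarrow> qsym" (infixl \<open>\<star>\<close> 70) where
  "x \<star> y = lin_ext fscale (\<lambda>u. lin_ext fscale (\<lambda>v. \<Sum>w\<leftarrow>quasi_shuffles u v. M w) y) x"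

definition qsym_Delta :: "qsym \<Rightarrow> (composition \<times> composition \<Rightarrow>\<^sub>0 rat)" where
  "qsym_Delta = lin_ext fscale (\<lambda>w. \<Sum>(u, v)\<in>{(u, v). u @ v = w}. M u \<otimes> M v)"

definition qsym_eps :: "qsym \<Rightarrow> rat" where
  "qsym_eps = lin_ext (*) (\<lambda>u. if u = [] then 1 else 0)"

text \<open>The factorizations of \<open>w\<close> into \<open>k\<close> nonempty compositions.\<close>

definition factorizations :: "composition \<Rightarrow> nat \<Rightarrow> composition list set" where
  "factorizations w k = {ws. length ws = k \<and> concat ws = w \<and> [] \<notin> set ws}"

definition qsym_delta :: "qsym \<Rightarrow> (composition \<times> composition \<Rightarrow>\<^sub>0 rat)" where
  "qsym_delta = lin_ext fscale (\<lambda>w. if w = [] then M [] \<otimes> M [] else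
     (\<Sum>k=1..length w. \<Sum>ws\<in>factorizations w k.
        M (map weight ws) \<otimes> foldr (\<star>) (map M ws) (M [])))"

definition qsym_eps' :: "qsym \<Rightarrow> rat" where
  "qsym_eps' = lin_ext (*) (\<lambda>u. if length u \<le> 1 then 1 else 0)"

text \<open>The index sets of the sums above are finite.\<close>

lemma finite_deconcatenations: "finite {(u, v). u @ v = w}"
proof (rule finite_subset)
  show "{(u, v). u @ v = w} \<subseteq> (\<lambda>i. (take i w, drop i w)) ` {..length w}"
  proof clarify
    fix u v assume "w = u @ v"
    then show "(u, v) \<in> (\<lambda>i. (take i (u @ v), drop i (u @ v))) ` {..length (u @ v)}"
      by (intro image_eqI[of _ _ "length u"]) simp_all
  qed
qed simp

lemma finite_factorizations: "finite (factorizations w k)"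
proof (rule finite_subset)
  let ?S = "{v. set v \<subseteq> set w \<and> length v \<le> length w}"
  show "finite {ws. set ws \<subseteq> ?S \<and> length ws = k}"
    by (intro finite_lists_length_eq finite_lists_length_le) simp
  have "length v \<le> length (concat ws)" if "v \<in> set ws" for v and ws :: "composition list"
    using that by (induction ws) auto
  then show "factorizations w k \<subseteq> {ws. set ws \<subseteq> ?S \<and> length ws = k}"
    by (auto simp: factorizations_def)
qed


section \<open>Realization in commuting variables\<close>

text \<open>
  The polynomial obtained from the realization of $M_u$ by keeping only a finite set \<open>A\<close> of letters
  of the alphabet. Since a monomial involves finitely many letters, the multiplicativity for all
  finite \<open>A\<close> shown below amounts to multiplicativity of the realization in formal power series.
\<close>

definition realization :: "('i::linorder \<Rightarrow> 'a::comm_semiring_1) \<Rightarrow> 'i set \<Rightarrow> composition \<Rightarrow> 'a" where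
  "realization x A u =
     (\<Sum>is\<in>{is. length is = length u \<and> sorted_wrt (<) is \<and> set is \<subseteq> A}.
        \<Prod>j<length u. x (is ! j) ^ Rep_posnat (u ! j))"

lemma realization_Nil: "realization x A [] = 1"
proof -
  have "{is. length is = length ([]::composition) \<and> sorted_wrt (<) is \<and> set is \<subseteq> A} = {[]}"
    by auto
  then show ?thesis unfolding realization_def by simp
qed

lemma realization_empty: "realization x {} (a # u) = 0"
proof -
  have *: "{is. length is = length (a # u) \<and> sorted_wrt (<) is \<and> set is \<subseteq> {}} = {}"
    by auto
  show ?thesis unfolding realization_def * by simp
qed

lemma realization_insert:
  assumes "finite A" "\<forall>i\<in>A. b < i"
  shows "realization x (insert b A) (a # u) =
    realization x A (a # u) + x b ^ Rep_posnat a * realization x A u"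
proof -
  let ?S = "\<lambda>A u. {is. length is = length (u::composition) \<and> sorted_wrt (<) is \<and> set is \<subseteq> A}"
  let ?f = "\<lambda>u is. \<Prod>j<length u. x (is ! j) ^ Rep_posnat (u ! j)"
  have fin: "finite (?S A u)" for u
    by (rule finite_subset[OF _ finite_lists_length_eq[OF assms(1), of "length u"]]) auto
  have split: "?S (insert b A) (a # u) = ?S A (a # u) \<union> (#) b ` ?S A u" (is "?L = ?R")
  proof
    show "?R \<subseteq> ?L" using assms(2) by (auto simp: subset_iff)
    show "?L \<subseteq> ?R"
    proof
      fix "is" assume "is \<in> ?L"
      then obtain i js where is_eq: "is = i # js" "length js = length u" "sorted_wrt (<) js"
        "\<forall>j\<in>set js. i < j" "i \<in> insert b A" "set js \<subseteq> insert b A"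
        by (cases "is") auto
      have "b \<le> i" using is_eq(5) assms(2) by auto
      then have "b \<notin> set js" using is_eq(4) by auto
      then have js: "set js \<subseteq> A" using is_eq(6) by auto
      show "is \<in> ?R" using is_eq js by (cases "i = b") auto
    qed
  qed
  have disj: "?S A (a # u) \<inter> (#) b ` ?S A u = {}" using assms(2) by auto
  have shift: "?f (a # u) (b # js) = x b ^ Rep_posnat a * ?f u js" for js
    by (simp add: prod.lessThan_Suc_shift del: prod.lessThan_Suc)
  have "realization x (insert b A) (a # u) =
      sum (?f (a # u)) (?S A (a # u)) + sum (?f (a # u)) ((#) b ` ?S A u)"
    unfolding realization_def split
    by (rule sum.union_disjoint[OF fin finite_imageI[OF fin] disj])
  also have "sum (?f (a # u)) ((#) b ` ?S A u) = x b ^ Rep_posnat a * realization x A u"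
    by (subst sum.reindex) (simp_all only: o_def shift realization_def sum_distrib_left inj_on_Cons1)
  finally show ?thesis by (simp only: realization_def)
qed

lemma realization_mult:
  assumes "finite A"
  shows "(\<Sum>w\<leftarrow>quasi_shuffles u v. realization x A w) = realization x A u * realization x A v"
  using assms
proof (induction A arbitrary: u v rule: finite_linorder_min_induct)
  case empty
  show ?case
    by (cases "(u, v)" rule: quasi_shuffles.cases)
       (simp_all add: realization_Nil realization_empty o_def)
next
  case (insert b A)
  have cons: "(\<Sum>w\<leftarrow>ws. realization x (insert b A) (c # w)) =
      (\<Sum>w\<leftarrow>map ((#) c) ws. realization x A w)
      + x b ^ Rep_posnat c * (\<Sum>w\<leftarrow>ws. realization x A w)" for c ws
    by (simp add: realization_insert[OF insert.hyps(1,2)] sum_list_addf sum_list_const_mult o_def)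
  show ?case
  proof (cases "(u, v)" rule: quasi_shuffles.cases)
    case (3 a u' c v')
    let ?r = "realization x A"
    have "(\<Sum>w\<leftarrow>quasi_shuffles u v. realization x (insert b A) w) =
      (\<Sum>w\<leftarrow>quasi_shuffles (a # u') (c # v'). ?r w)
      + x b ^ Rep_posnat a * (\<Sum>w\<leftarrow>quasi_shuffles u' (c # v'). ?r w)
      + x b ^ Rep_posnat c * (\<Sum>w\<leftarrow>quasi_shuffles (a # u') v'. ?r w)
      + x b ^ Rep_posnat (a + c) * (\<Sum>w\<leftarrow>quasi_shuffles u' v'. ?r w)"
      using 3 by (simp add: cons o_def algebra_simps)
    also have "\<dots> = realization x (insert b A) u * realization x (insert b A) v"
      using 3 unfolding insert.IH
      by (simp add: realization_insert[OF insert.hyps(1,2)] plus_posnat.rep_eq power_add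
          algebra_simps)
    finally show ?thesis .
  qed (simp_all add: realization_Nil)
qed


section \<open>Rational polynomials\<close>

text \<open>
  $\mathbb{Q}[X]\otimes\mathbb{Q}[X]$ is \<open>nat \<times> nat \<Rightarrow>\<^sub>0 rat\<close>, where \<open>(i, j)\<close> stands for
  $X^i\otimes X^j$. The product on this type coming from \<open>Poly_Mapping\<close> (convolution along the
  componentwise addition of exponents) is the product of the tensor product algebra.
\<close>

definition poly_tensor :: "rat poly \<Rightarrow> rat poly \<Rightarrow> (nat \<times> nat \<Rightarrow>\<^sub>0 rat)" where
  "poly_tensor p q = (\<Sum>i\<le>degree p. \<Sum>j\<le>degree q.
      Poly_Mapping.single (i, j) (coeff p i * coeff q j))"

text \<open>The algebra morphism from $\mathbb{Q}[X]$ to $\mathbb{Q}[X]\otimes\mathbb{Q}[X]$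
  sending $X$ to \<open>t\<close>.\<close>

definition poly_subst :: "(nat \<times> nat \<Rightarrow>\<^sub>0 rat) \<Rightarrow> rat poly \<Rightarrow> (nat \<times> nat \<Rightarrow>\<^sub>0 rat)" where
  "poly_subst t p = (\<Sum>i\<le>degree p. fscale (coeff p i) (t ^ i))"

definition polyX :: "rat poly" where
  "polyX = [:0, 1:]"

definition poly_Delta :: "rat poly \<Rightarrow> (nat \<times> nat \<Rightarrow>\<^sub>0 rat)" where
  "poly_Delta = poly_subst (poly_tensor polyX 1 + poly_tensor 1 polyX)"

definition poly_eps :: "rat poly \<Rightarrow> rat" where
  "poly_eps p = poly p 0"

definition poly_delta :: "rat poly \<Rightarrow> (nat \<times> nat \<Rightarrow>\<^sub>0 rat)" where
  "poly_delta = poly_subst (poly_tensor polyX polyX)"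

definition poly_eps' :: "rat poly \<Rightarrow> rat" where
  "poly_eps' p = poly p 1"


section \<open>Morphisms\<close>

text \<open>The map $f\otimes f$ on $\mathrm{QSym}\otimes\mathrm{QSym}$, for linear \<open>f\<close>.\<close>

definition map_tensor :: "(qsym \<Rightarrow> rat poly) \<Rightarrow>
    (composition \<times> composition \<Rightarrow>\<^sub>0 rat) \<Rightarrow> (nat \<times> nat \<Rightarrow>\<^sub>0 rat)" where
  "map_tensor f = lin_ext fscale (\<lambda>(u, v). poly_tensor (f (M u)) (f (M v)))"

definition algebra_morphism :: "(qsym \<Rightarrow> rat poly) \<Rightarrow> bool" where
  "algebra_morphism f \<longleftrightarrow> Vector_Spaces.linear fscale smult f \<and>
     f (M []) = 1 \<and> (\<forall>x y. f (x \<star> y) = f x * f y)"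

definition coalgebra_morphism ::
  "(qsym \<Rightarrow> (composition \<times> composition \<Rightarrow>\<^sub>0 rat)) \<Rightarrow> (qsym \<Rightarrow> rat) \<Rightarrow>
   (rat poly \<Rightarrow> (nat \<times> nat \<Rightarrow>\<^sub>0 rat)) \<Rightarrow> (rat poly \<Rightarrow> rat) \<Rightarrow> (qsym \<Rightarrow> rat poly) \<Rightarrow> bool" where
  "coalgebra_morphism D e D' e' f \<longleftrightarrow> Vector_Spaces.linear fscale smult f \<and>
     (\<forall>x. D' (f x) = map_tensor f (D x)) \<and> (\<forall>x. e' (f x) = e x)"

text \<open>A Hopf algebra morphism is a bialgebra morphism between Hopf algebras; it preserves the
  antipodes automatically.\<close>

definition Delta_hopf_morphism :: "(qsym \<Rightarrow> rat poly) \<Rightarrow> bool" where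
  "Delta_hopf_morphism f \<longleftrightarrow>
     algebra_morphism f \<and> coalgebra_morphism qsym_Delta qsym_eps poly_Delta poly_eps f"

definition delta_bialgebra_morphism :: "(qsym \<Rightarrow> rat poly) \<Rightarrow> bool" where
  "delta_bialgebra_morphism f \<longleftrightarrow>
     algebra_morphism f \<and> coalgebra_morphism qsym_delta qsym_eps' poly_delta poly_eps' f"

definition hilbert_poly :: "nat \<Rightarrow> rat poly" where
  "hilbert_poly k = smult (1 / fact k) (\<Prod>i<k. polyX - of_nat i)"

definition hilbert_map :: "qsym \<Rightarrow> rat poly" where
  "hilbert_map = lin_ext smult (\<lambda>u. hilbert_poly (length u))"

end

theory Submission
  imports Defs
begin

text \<open>
  A rational polynomial is determined by its values at the natural numbers, and an element of
  $\mathbb{Q}[X]\otimes\mathbb{Q}[X]$ by its values at pairs \<open>(a, b)\<close> of natural numbers.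
  Under these evaluations \<open>poly_Delta p\<close> becomes $p(a+b)$ and \<open>poly_delta p\<close> becomes $p(ab)$, while
  the image of \<open>M w\<close> under \<open>hilbert_map\<close> becomes the binomial coefficient
  $\binom{n}{\ell}$, with $\ell$ the length of \<open>w\<close>. Every property of \<open>hilbert_map\<close> is therefore an
  identity between binomial coefficients:

  \<^item> Multiplicativity: $\binom{n}{\ell}$ is the realization of \<open>M w\<close> in \<open>n\<close> variables, all
    specialised to 1, and realizations are multiplicative (\<open>hilbert_map_quasi_shuffles\<close>).
  \<^item> Compatibility with $\Delta$: Vandermonde's identity
    $\binom{a+b}{\ell}=\sum_i\binom{a}{i}\binom{b}{\ell-i}$.
  \<^item> Compatibility with $\delta$:
    $\binom{ab}{\ell}=\sum_k\binom{a}{k}\sum\binom{b}{\ell_1}\cdots\binom{b}{\ell_k}$, the inner sum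
    being over the compositions $(\ell_1,\ldots,\ell_k)$ of $\ell$: to choose $\ell$ points out of \<open>a\<close>
    blocks of size \<open>b\<close>, choose first the \<open>k\<close> blocks that are hit (\<open>binomial_of_product\<close>).
  \<^item> Counits: $\binom{0}{\ell}$ and $\binom{1}{\ell}$.

  For uniqueness, let \<open>F\<close> be such a morphism. The two counits prescribe the values of every
  \<open>F x\<close> at 0 and at 1, and compatibility with $\Delta$ expresses $F(M_w)(n+1)$ through values at
  \<open>n\<close> and at 1. So all values of \<open>F x\<close> at natural numbers are prescribed
  (\<open>Delta_morphism_unique\<close>).
\<close>

section \<open>Linear extension\<close>

lemma vector_space_mult_rat: "vector_space ((*) :: rat \<Rightarrow> rat \<Rightarrow> rat)"
  by unfold_locales (simp_all add: algebra_simps)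

text \<open>Summing over a common finite superset of the supports lets \<open>lin_ext s g x\<close> and
  \<open>lin_ext s g y\<close> be added termwise.\<close>

lemma lin_ext_superset:
  assumes "vector_space s" "finite S" "Poly_Mapping.keys x \<subseteq> S"
  shows "lin_ext s g x = (\<Sum>b\<in>S. s (Poly_Mapping.lookup x b) (g b))"
proof -
  interpret vector_space s by fact
  show ?thesis
    unfolding lin_ext_def using assms(2,3)
    by (intro sum.mono_neutral_left) (auto simp: in_keys_iff)
qed

lemma linear_lin_ext:
  assumes "vector_space s"
  shows "Vector_Spaces.linear fscale s (lin_ext s g)"
proof -
  interpret T: vector_space s by fact
  have "lin_ext s g (x + y) = lin_ext s g x + lin_ext s g y" for x y
  proof -
    let ?S = "Poly_Mapping.keys x \<union> Poly_Mapping.keys y"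
    have ext: "lin_ext s g z = (\<Sum>b\<in>?S. s (Poly_Mapping.lookup z b) (g b))"
      if "Poly_Mapping.keys z \<subseteq> ?S" for z
      using that by (intro lin_ext_superset[OF assms]) simp_all
    show ?thesis
      by (simp add: ext keys_add lookup_add T.scale_left_distrib sum.distrib)
  qed
  moreover have "lin_ext s g (fscale c x) = s c (lin_ext s g x)" for c x
  proof -
    have "Poly_Mapping.keys (fscale c x) \<subseteq> Poly_Mapping.keys x"
      by (auto simp: in_keys_iff)
    then have "lin_ext s g (fscale c x) =
        (\<Sum>b\<in>Poly_Mapping.keys x. s (Poly_Mapping.lookup (fscale c x) b) (g b))"
      by (intro lin_ext_superset[OF assms]) simp_all
    then show ?thesis
      by (simp add: lin_ext_def T.scale_sum_right)
  qed
  ultimately show ?thesis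
    by (simp add: Vector_Spaces.linear_iff vector_space_fscale assms)
qed

lemma lin_ext_single:
  assumes "vector_space s"
  shows "lin_ext s g (Poly_Mapping.single b c) = s c (g b)"
proof -
  interpret vector_space s by fact
  show ?thesis
    using lin_ext_superset[OF assms, of "{b}" "Poly_Mapping.single b c" g] by simp
qed

lemma lin_ext_M [simp]:
  assumes "vector_space s"
  shows "lin_ext s g (M u) = g u"
proof -
  interpret vector_space s by fact
  show ?thesis by (simp add: M_def lin_ext_single[OF assms])
qed

lemma linear_map_sum:
  assumes "Vector_Spaces.linear s t f"
  shows "f (sum g A) = (\<Sum>a\<in>A. f (g a))"
proof -
  interpret Vector_Spaces.linear s t f by fact
  show ?thesis by (rule sum)
qed

lemma linear_map_scale:
  assumes "Vector_Spaces.linear s t f"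
  shows "f (s c x) = t c (f x)"
proof -
  interpret Vector_Spaces.linear s t f by fact
  show ?thesis by (rule scale)
qed

lemma linear_lin_ext_comp:
  assumes "Vector_Spaces.linear s t f"
  shows "f (lin_ext s g x) = lin_ext t (\<lambda>b. f (g b)) x"
  by (simp add: lin_ext_def linear_map_sum[OF assms] linear_map_scale[OF assms])

lemma sum_single_lookup:
  "(\<Sum>k\<in>Poly_Mapping.keys x. Poly_Mapping.single k (Poly_Mapping.lookup x k)) = x"
  by (rule poly_mapping_eqI) (auto simp: lookup_sum lookup_single when_def in_keys_iff)

lemma linear_eq_lin_ext:
  assumes "Vector_Spaces.linear fscale t f"
  shows "f x = lin_ext t (\<lambda>b. f (Poly_Mapping.single b 1)) x"
proof -
  have "lin_ext fscale (\<lambda>b. Poly_Mapping.single b 1) x =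
      (\<Sum>b\<in>Poly_Mapping.keys x. Poly_Mapping.single b (Poly_Mapping.lookup x b))"
    unfolding lin_ext_def
    by (intro sum.cong poly_mapping_eqI) (simp_all add: lookup_single when_def)
  then show ?thesis
    using linear_lin_ext_comp[OF assms, of "\<lambda>b. Poly_Mapping.single b 1" x]
    by (simp add: sum_single_lookup)
qed

lemma linear_eqI:
  assumes "Vector_Spaces.linear fscale t f" "Vector_Spaces.linear fscale t g"
    and "\<And>u. f (M u) = g (M u)"
  shows "f x = g x"
  using linear_eq_lin_ext[OF assms(1), of x] linear_eq_lin_ext[OF assms(2), of x] assms(3)
  by (simp add: M_def)


section \<open>Evaluation of polynomials and tensors\<close>

lemma poly_eqI_nat:
  fixes p q :: "rat poly"
  assumes "\<And>n::nat. poly p (of_nat n) = poly q (of_nat n)"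
  shows "p = q"
proof (rule ccontr)
  assume "p \<noteq> q"
  then have "finite {x. poly (p - q) x = 0}" by (intro poly_roots_finite) simp
  moreover have "range of_nat \<subseteq> {x. poly (p - q) x = 0}" using assms by auto
  ultimately have "finite (range (of_nat :: nat \<Rightarrow> rat))" by (rule rev_finite_subset)
  then show False by (simp add: finite_image_iff inj_on_def)
qed

lemma linear_poly: "Vector_Spaces.linear smult (*) (\<lambda>p. poly p a :: rat)"
  by (simp add: Vector_Spaces.linear_iff vector_space_smult_poly vector_space_mult_rat)

lemma linear_poly_comp:
  assumes "Vector_Spaces.linear s smult f"
  shows "Vector_Spaces.linear s (*) (\<lambda>x. poly (f x) a :: rat)"
  using Vector_Spaces.linear_compose[OF assms linear_poly] by (simp add: o_def)

text \<open>The algebra morphism $X^i\otimes X^j\mapsto a^ib^j$.\<close>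

definition tensor_eval :: "rat \<Rightarrow> rat \<Rightarrow> (nat \<times> nat \<Rightarrow>\<^sub>0 rat) \<Rightarrow> rat" where
  "tensor_eval a b = lin_ext (*) (\<lambda>(i, j). a ^ i * b ^ j)"

lemma linear_tensor_eval: "Vector_Spaces.linear fscale (*) (tensor_eval a b)"
  unfolding tensor_eval_def by (rule linear_lin_ext[OF vector_space_mult_rat])

lemmas tensor_eval_sum = linear_map_sum[OF linear_tensor_eval]
lemmas tensor_eval_fscale = linear_map_scale[OF linear_tensor_eval]

lemma tensor_eval_add: "tensor_eval a b (x + y) = tensor_eval a b x + tensor_eval a b y"
  using linear_tensor_eval[of a b] by (simp add: Vector_Spaces.linear_iff)

lemma tensor_eval_single:
  "tensor_eval a b (Poly_Mapping.single (i, j) c) = c * (a ^ i * b ^ j)"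
  by (simp add: tensor_eval_def lin_ext_single vector_space_mult_rat)

lemma tensor_eval_mult: "tensor_eval a b (x * y) = tensor_eval a b x * tensor_eval a b y"
proof -
  have single: "tensor_eval a b (Poly_Mapping.single k c * Poly_Mapping.single l d) =
      tensor_eval a b (Poly_Mapping.single k c) * tensor_eval a b (Poly_Mapping.single l d)" for k l c d
    by (cases k; cases l) (simp add: mult_single tensor_eval_single power_add)
  let ?m = "\<lambda>x. \<Sum>k\<in>Poly_Mapping.keys x. Poly_Mapping.single k (Poly_Mapping.lookup x k)"
  have "tensor_eval a b (?m x * ?m y) = tensor_eval a b (?m x) * tensor_eval a b (?m y)"
    by (simp only: sum_product tensor_eval_sum single)
  then show ?thesis by (simp only: sum_single_lookup)
qed

lemma tensor_eval_power: "tensor_eval a b (t ^ n) = tensor_eval a b t ^ n"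
proof (induction n)
  case 0
  have one: "(1 :: nat \<times> nat \<Rightarrow>\<^sub>0 rat) = Poly_Mapping.single (0, 0) 1"
    by (metis single_one zero_prod_def)
  have "tensor_eval a b 1 = 1"
    unfolding one by (subst tensor_eval_single) simp
  then show ?case by simp
qed (simp add: tensor_eval_mult)

lemma tensor_eval_poly_tensor: "tensor_eval a b (poly_tensor p q) = poly p a * poly q b"
  by (simp add: poly_tensor_def tensor_eval_sum tensor_eval_single poly_altdef sum_product
      algebra_simps)

lemma tensor_eval_poly_subst: "tensor_eval a b (poly_subst t p) = poly p (tensor_eval a b t)"
  by (simp add: poly_subst_def tensor_eval_sum tensor_eval_fscale tensor_eval_power poly_altdef)

lemma tensor_eval_poly_Delta: "tensor_eval a b (poly_Delta p) = poly p (a + b)"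
  by (simp add: poly_Delta_def tensor_eval_poly_subst tensor_eval_add tensor_eval_poly_tensor polyX_def)

lemma tensor_eval_poly_delta: "tensor_eval a b (poly_delta p) = poly p (a * b)"
  by (simp add: poly_delta_def tensor_eval_poly_subst tensor_eval_poly_tensor polyX_def)

text \<open>
  The vanishing of a two-variable polynomial on a grid is reduced to one variable twice: fixing
  the first variable yields the coefficients with respect to the second one, and these are
  polynomials in the first variable that again agree at all natural numbers.
\<close>

lemma tensor_eqI:
  assumes "\<And>a b :: nat. tensor_eval (of_nat a) (of_nat b) s = tensor_eval (of_nat a) (of_nat b) t"
  shows "s = t"
proof (rule poly_mapping_eqI, clarify)
  fix i j :: nat
  define S where "S = Poly_Mapping.keys s \<union> Poly_Mapping.keys t"
  define I where "I = fst ` S"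
  define J where "J = snd ` S"
  have fin: "finite I" "finite J" by (simp_all add: S_def I_def J_def)
  have sub: "S \<subseteq> I \<times> J" by (force simp: I_def J_def)
  \<comment> \<open>the tensor as a polynomial in the second variable, the first being specialised to \<open>a\<close>\<close>
  define P where "P r a = (\<Sum>j\<in>J. monom (\<Sum>i\<in>I. Poly_Mapping.lookup r (i, j) * a ^ i) j)"
    for r :: "nat \<times> nat \<Rightarrow>\<^sub>0 rat" and a
  \<comment> \<open>the coefficient of degree \<open>j\<close> in the second variable, as a polynomial in the first\<close>
  define Q where "Q r j = (\<Sum>i\<in>I. monom (Poly_Mapping.lookup r (i, j)) i)"
    for r :: "nat \<times> nat \<Rightarrow>\<^sub>0 rat" and j
  have eval: "tensor_eval a b r = poly (P r a) b" if "Poly_Mapping.keys r \<subseteq> S" for r a b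
  proof -
    have "tensor_eval a b r =
        (\<Sum>(i, j)\<in>I \<times> J. Poly_Mapping.lookup r (i, j) * (a ^ i * b ^ j))"
      unfolding tensor_eval_def
      using lin_ext_superset[OF vector_space_mult_rat, of "I \<times> J" r] fin that sub
      by (auto simp: case_prod_unfold)
    also have "\<dots> = poly (P r a) b"
      unfolding P_def sum.cartesian_product[symmetric]
      by (subst sum.swap) (simp add: poly_sum poly_monom sum_distrib_left sum_distrib_right mult_ac)
    finally show ?thesis .
  qed
  have "P s (of_nat a) = P t (of_nat a)" for a
    using assms by (intro poly_eqI_nat) (simp add: eval[symmetric] S_def)
  moreover have "poly (Q r j) a = coeff (P r a) j" if "j \<in> J" for r a
    using that fin by (simp add: P_def Q_def coeff_sum poly_sum poly_monom sum.delta')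
  ultimately have Q: "Q s j = Q t j" if "j \<in> J"
    using that by (intro poly_eqI_nat) simp
  have coeff_Q: "coeff (Q r j) i = Poly_Mapping.lookup r (i, j)" if "i \<in> I" for r
    using that fin by (simp add: Q_def coeff_sum sum.delta')
  show "Poly_Mapping.lookup s (i, j) = Poly_Mapping.lookup t (i, j)"
  proof (cases "(i, j) \<in> S")
    case True
    then have "i \<in> I" "j \<in> J" using sub by auto
    then show ?thesis using Q coeff_Q by metis
  next
    case False
    then show ?thesis by (auto simp: S_def in_keys_iff)
  qed
qed


section \<open>Linear maps on quasisymmetric functions\<close>

lemma linear_map_tensor: "Vector_Spaces.linear fscale fscale (map_tensor f)"
  unfolding map_tensor_def by (rule linear_lin_ext[OF vector_space_fscale])

lemma tensor_eval_map_tensor_ftensor: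
  assumes f: "Vector_Spaces.linear fscale smult f"
  shows "tensor_eval a b (map_tensor f (x \<otimes> y)) = poly (f x) a * poly (f y) b"
proof -
  have ev: "poly (f z) c = (\<Sum>u\<in>Poly_Mapping.keys z. Poly_Mapping.lookup z u * poly (f (M u)) c)" for z c
    by (subst linear_eq_lin_ext[OF f])
       (simp add: linear_lin_ext_comp[OF linear_poly] lin_ext_def M_def poly_sum)
  have single: "tensor_eval a b (map_tensor f (Poly_Mapping.single (u, v) c)) =
      c * (poly (f (M u)) a * poly (f (M v)) b)" for u v c
    by (simp add: map_tensor_def lin_ext_single vector_space_fscale tensor_eval_fscale
        tensor_eval_poly_tensor)
  show ?thesis
    unfolding ftensor_def linear_map_sum[OF linear_map_tensor] tensor_eval_sum single ev[of x] ev[of y]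
      sum_product
    by (simp add: mult_ac)
qed

lemma sum_deconcatenations:
  "(\<Sum>(u, v)\<in>{(u, v). u @ v = w}. f u v) =
    (\<Sum>i\<le>length w. f (take i w) (drop i w))"
  by (rule sum.reindex_bij_witness[of _ "\<lambda>i. (take i w, drop i w)" "\<lambda>(u, v). length u"]) auto

text \<open>
  The common pattern of both coproducts: \<open>h\<close> is addition for $\Delta$ and multiplication for
  $\delta$. All maps involved are linear, so the compatibility is reduced to the basis of
  $\mathrm{QSym}$ and to values at pairs of natural numbers.
\<close>

lemma coproduct_compatibleI:
  fixes f :: "qsym \<Rightarrow> rat poly"
  assumes f: "Vector_Spaces.linear fscale smult f"
    and D: "Vector_Spaces.linear fscale fscale D"
    and eval_D': "\<And>a b p. tensor_eval a b (D' p) = poly p (h a b)"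
    and basis: "\<And>(a::nat) (b::nat) w. poly (f (M w)) (h (of_nat a) (of_nat b)) =
      tensor_eval (of_nat a) (of_nat b) (map_tensor f (D (M w)))"
  shows "D' (f x) = map_tensor f (D x)"
proof (rule tensor_eqI)
  fix a b :: nat
  have "Vector_Spaces.linear fscale (*)
      (\<lambda>x. tensor_eval (of_nat a) (of_nat b) (map_tensor f (D x)))"
    using Vector_Spaces.linear_compose[OF
        Vector_Spaces.linear_compose[OF D linear_map_tensor] linear_tensor_eval]
    by (simp add: o_def)
  with linear_poly_comp[OF f] show "tensor_eval (of_nat a) (of_nat b) (D' (f x)) =
      tensor_eval (of_nat a) (of_nat b) (map_tensor f (D x))"
    unfolding eval_D' using basis by (rule linear_eqI)
qed

lemma linear_qsym_Delta: "Vector_Spaces.linear fscale fscale qsym_Delta"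
  unfolding qsym_Delta_def by (rule linear_lin_ext[OF vector_space_fscale])

lemma tensor_eval_qsym_Delta:
  assumes f: "Vector_Spaces.linear fscale smult f"
  shows "tensor_eval a b (map_tensor f (qsym_Delta (M w))) =
    (\<Sum>i\<le>length w. poly (f (M (take i w))) a * poly (f (M (drop i w))) b)"
  by (simp add: qsym_Delta_def vector_space_fscale sum_deconcatenations
      linear_map_sum[OF linear_map_tensor] tensor_eval_sum tensor_eval_map_tensor_ftensor[OF f])


section \<open>Hilbert polynomials\<close>

lemma poly_hilbert_poly: "poly (hilbert_poly k) (of_nat n) = of_nat (n choose k)"
  by (simp add: hilbert_poly_def poly_prod polyX_def binomial_gbinomial gbinomial_prod_rev
      atLeast0LessThan)

lemma linear_hilbert_map: "Vector_Spaces.linear fscale smult hilbert_map"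
  unfolding hilbert_map_def by (rule linear_lin_ext[OF vector_space_smult_poly])

lemma hilbert_map_M: "hilbert_map (M u) = hilbert_poly (length u)"
  by (simp add: hilbert_map_def vector_space_smult_poly)

lemma poly_hilbert_map_M: "poly (hilbert_map (M u)) (of_nat n) = of_nat (n choose length u)"
  by (simp add: hilbert_map_M poly_hilbert_poly)

text \<open>With all variables equal to 1, the realization counts the strictly increasing sequences of
  the given length in \<open>A\<close>.\<close>

lemma realization_one: "finite A \<Longrightarrow> realization (\<lambda>_. 1 :: rat) A u = of_nat (card A choose length u)"
proof (induction A arbitrary: u rule: finite_linorder_min_induct)
  case empty
  then show ?case by (cases u) (simp_all add: realization_Nil realization_empty)
next
  case (insert b A)
  then have "b \<notin> A" by auto
  with insert show ?case
    by (cases u) (simp_all add: realization_Nil realization_insert)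
qed

lemma hilbert_map_quasi_shuffles:
  "(\<Sum>w\<leftarrow>quasi_shuffles u v. hilbert_map (M w)) = hilbert_map (M u) * hilbert_map (M v)"
proof (rule poly_eqI_nat)
  fix n :: nat
  have one: "poly (hilbert_map (M w)) (of_nat n) = realization (\<lambda>_. 1) {..<n} w" for w
    by (simp add: poly_hilbert_map_M realization_one)
  have "poly (sum_list (map g ws)) c = (\<Sum>w\<leftarrow>ws. poly (g w) c)"
    for g :: "composition \<Rightarrow> rat poly" and ws c
    by (induction ws) simp_all
  then show "poly (\<Sum>w\<leftarrow>quasi_shuffles u v. hilbert_map (M w)) (of_nat n) =
      poly (hilbert_map (M u) * hilbert_map (M v)) (of_nat n)"
    by (simp add: one realization_mult)
qed

lemma hilbert_map_mult: "hilbert_map (x \<star> y) = hilbert_map x * hilbert_map y"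
proof -
  interpret V: vector_space "smult :: rat \<Rightarrow> rat poly \<Rightarrow> rat poly"
    by (rule vector_space_smult_poly)
  note comp = linear_lin_ext_comp[OF linear_hilbert_map]
  have list: "hilbert_map (\<Sum>w\<leftarrow>ws. M w) = (\<Sum>w\<leftarrow>ws. hilbert_map (M w))" for ws
    using linear_hilbert_map
    by (induction ws) (simp_all add: Vector_Spaces.linear_iff hilbert_map_def lin_ext_def)
  have ext: "hilbert_map z = lin_ext smult (\<lambda>u. hilbert_map (M u)) z" for z
    using linear_eq_lin_ext[OF linear_hilbert_map, of z] by (simp add: M_def)
  have "hilbert_map (x \<star> y) =
      lin_ext smult (\<lambda>u. lin_ext smult (\<lambda>v. hilbert_map (M u) * hilbert_map (M v)) y) x"
    by (simp add: qsym_mult_def comp list hilbert_map_quasi_shuffles)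
  also have "\<dots> = lin_ext smult (\<lambda>u. hilbert_map (M u)) x * lin_ext smult (\<lambda>v. hilbert_map (M v)) y"
    by (simp add: lin_ext_def sum_product mult_ac V.scale_sum_right)
  finally show ?thesis by (simp flip: ext)
qed

lemma algebra_morphism_hilbert_map: "algebra_morphism hilbert_map"
  by (simp add: algebra_morphism_def linear_hilbert_map hilbert_map_mult hilbert_map_M
      hilbert_poly_def)

lemma coalgebra_morphism_Delta_hilbert_map:
  "coalgebra_morphism qsym_Delta qsym_eps poly_Delta poly_eps hilbert_map"
  unfolding coalgebra_morphism_def
proof (intro conjI allI linear_hilbert_map)
  fix x
  show "poly_Delta (hilbert_map x) = map_tensor hilbert_map (qsym_Delta x)"
  proof (rule coproduct_compatibleI[OF linear_hilbert_map linear_qsym_Delta tensor_eval_poly_Delta])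
    fix a b :: nat and w :: composition
    have "poly (hilbert_map (M w)) (of_nat (a + b)) =
        of_nat (\<Sum>i\<le>length w. (a choose i) * (b choose (length w - i)))"
      by (simp only: poly_hilbert_map_M vandermonde)
    then show "poly (hilbert_map (M w)) (of_nat a + of_nat b) =
        tensor_eval (of_nat a) (of_nat b) (map_tensor hilbert_map (qsym_Delta (M w)))"
      by (simp add: tensor_eval_qsym_Delta[OF linear_hilbert_map] poly_hilbert_map_M min_absorb2
          cong: sum.cong_simp)
  qed
  have "(\<lambda>x. poly (hilbert_map x) 0) x = qsym_eps x"
  proof (rule linear_eqI)
    show "Vector_Spaces.linear fscale (*) (\<lambda>x. poly (hilbert_map x) 0)"
      by (rule linear_poly_comp[OF linear_hilbert_map])
    show "Vector_Spaces.linear fscale (*) qsym_eps"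
      unfolding qsym_eps_def by (rule linear_lin_ext[OF vector_space_mult_rat])
    show "poly (hilbert_map (M u)) 0 = qsym_eps (M u)" for u
      using poly_hilbert_map_M[of u 0]
      by (cases u) (simp_all add: qsym_eps_def vector_space_mult_rat)
  qed
  then show "poly_eps (hilbert_map x) = qsym_eps x" by (simp add: poly_eps_def)
qed


section \<open>Compatibility with the second coproduct\<close>

lemma factorizations_0: "factorizations w 0 = (if w = [] then {[]} else {})"
  by (auto simp: factorizations_def)

lemma sum_factorizations_Suc:
  "(\<Sum>ws\<in>factorizations w (Suc k). f ws) =
    (\<Sum>(u, v)\<in>{(u, v). u @ v = w \<and> u \<noteq> []}. \<Sum>ws\<in>factorizations v k. f (u # ws))"
proof -
  have fin: "finite {(u, v). u @ v = w \<and> u \<noteq> []}"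
    by (rule finite_subset[OF _ finite_deconcatenations[of w]]) auto
  have "(\<Sum>(u, v)\<in>{(u, v). u @ v = w \<and> u \<noteq> []}. \<Sum>ws\<in>factorizations v k. f (u # ws)) =
      (\<Sum>((u, v), ws)\<in>(SIGMA p:{(u, v). u @ v = w \<and> u \<noteq> []}. factorizations (snd p) k). f (u # ws))"
    by (subst sum.Sigma[symmetric]) (auto simp: fin finite_factorizations intro!: sum.cong)
  also have "\<dots> = (\<Sum>ws\<in>factorizations w (Suc k). f ws)"
    by (rule sum.reindex_bij_witness[of _ "\<lambda>ws. ((hd ws, concat (tl ws)), tl ws)"
          "\<lambda>((u, v), ws). u # ws"])
       (auto simp: factorizations_def length_Suc_conv)
  finally show ?thesis ..
qed

text \<open>
  By induction on the number \<open>a\<close> of blocks. Write $P(w,k)$ for the inner sum. Pascal's rule for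
  \<open>Suc a choose k\<close> splits the sum in two: the part with \<open>a choose k\<close> is the sum for \<open>a\<close> and \<open>w\<close>
  (the new block is not hit); in the part with \<open>a choose (k - 1)\<close>, splitting off the first factor
  \<open>u\<close> leaves the sum for \<open>a\<close> and the rest \<open>v\<close> of the word. Together they range over all
  deconcatenations $w=uv$, and Vandermonde's identity adds them up to
  $\binom{b+ab}{\ell}$. The bound \<open>N\<close> is kept arbitrary because the second part
  is a sum over one index less.
\<close>

lemma binomial_of_product:
  assumes "length w < N"
  shows "(\<Sum>k<N. (a choose k) * (\<Sum>ws\<in>factorizations w k. \<Prod>v\<leftarrow>ws. b choose length v)) =
    (a * b) choose length w"
  using assms
proof (induction a arbitrary: w N)
  case 0
  then obtain N' where N: "N = Suc N'" by (cases N) auto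
  show ?case
    unfolding N sum.lessThan_Suc_shift by (cases w) (simp_all add: factorizations_0)
next
  case (Suc a)
  then obtain N' where N: "N = Suc N'" by (cases N) auto
  define P where "P w k = (\<Sum>ws\<in>factorizations w k. \<Prod>v\<leftarrow>ws. b choose length v)" for w k
  let ?D = "{(u, v). u @ v = w \<and> u \<noteq> []}"
  have fin: "finite ?D"
    by (rule finite_subset[OF _ finite_deconcatenations[of w]]) auto
  have P_Suc: "P w (Suc k) = (\<Sum>(u, v)\<in>?D. (b choose length u) * P v k)" for k
    by (simp add: P_def sum_factorizations_Suc sum_distrib_left)
  have IH: "(\<Sum>k<n. (a choose k) * P v k) = (a * b) choose length v" if "length v < n" for v n
    using Suc.IH[OF that] by (simp add: P_def)
  have "(\<Sum>k<N. (Suc a choose k) * P w k) =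
      (\<Sum>k<N. (a choose k) * P w k) + (\<Sum>k<N'. (a choose k) * P w (Suc k))"
    unfolding N sum.lessThan_Suc_shift by (simp add: algebra_simps sum.distrib)
  also have "(\<Sum>k<N. (a choose k) * P w k) = (a * b) choose length w"
    using Suc.prems by (rule IH)
  also have "(\<Sum>k<N'. (a choose k) * P w (Suc k)) =
      (\<Sum>(u, v)\<in>?D. (b choose length u) * (\<Sum>k<N'. (a choose k) * P v k))"
    unfolding P_Suc sum_distrib_left case_prod_unfold by (subst sum.swap) (simp add: mult_ac)
  also have "\<dots> = (\<Sum>(u, v)\<in>?D. (b choose length u) * ((a * b) choose length v))"
    using Suc.prems N by (intro sum.cong refl) (auto simp flip: length_greater_0_conv intro!: IH)
  \<comment> \<open>the first part is the missing deconcatenation with empty left factor\<close>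
  also have "(a * b choose length w) + \<dots> =
      (\<Sum>(u, v)\<in>insert ([], w) ?D. (b choose length u) * ((a * b) choose length v))"
    using fin by (subst sum.insert) auto
  also have "insert ([], w) ?D = {(u, v). u @ v = w}" by auto
  also have "(\<Sum>(u, v)\<in>{(u, v). u @ v = w}. (b choose length u) * ((a * b) choose length v)) =
      (Suc a * b) choose length w"
    by (simp add: sum_deconcatenations vandermonde[symmetric] min_absorb2
        cong: sum.cong_simp)
  finally show ?case by (simp add: P_def)
qed

lemma linear_qsym_delta: "Vector_Spaces.linear fscale fscale qsym_delta"
  unfolding qsym_delta_def by (rule linear_lin_ext[OF vector_space_fscale])

text \<open>
  Allowing \<open>k = 0\<close> merges the two cases in the definition: only the empty word factors into no
  words, and its empty factorization contributes \<open>M [] \<otimes> M []\<close>.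
\<close>

lemma qsym_delta_M:
  "qsym_delta (M w) = (\<Sum>k<Suc (length w). \<Sum>ws\<in>factorizations w k.
     M (map weight ws) \<otimes> foldr (\<star>) (map M ws) (M []))"
proof (cases "w = []")
  case True
  then show ?thesis
    by (simp add: qsym_delta_def vector_space_fscale factorizations_0)
next
  case False
  have "{..<Suc (length w)} = insert 0 {1..length w}" by auto
  then show ?thesis
    using False by (simp add: qsym_delta_def vector_space_fscale factorizations_0)
qed

lemma coalgebra_morphism_delta_hilbert_map:
  "coalgebra_morphism qsym_delta qsym_eps' poly_delta poly_eps' hilbert_map"
  unfolding coalgebra_morphism_def
proof (intro conjI allI linear_hilbert_map)
  fix x
  show "poly_delta (hilbert_map x) = map_tensor hilbert_map (qsym_delta x)"
  proof (rule coproduct_compatibleI[OF linear_hilbert_map linear_qsym_delta tensor_eval_poly_delta])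
    fix a b :: nat and w :: composition
    have prod: "poly (hilbert_map (foldr (\<star>) (map M ws) (M []))) (of_nat b) =
        of_nat (\<Prod>v\<leftarrow>ws. b choose length v)" for ws
      by (induction ws) (simp_all add: hilbert_map_mult poly_hilbert_map_M)
    have "tensor_eval (of_nat a) (of_nat b) (map_tensor hilbert_map (qsym_delta (M w))) =
        (\<Sum>k<Suc (length w). \<Sum>ws\<in>factorizations w k.
          of_nat (a choose length ws) * of_nat (\<Prod>v\<leftarrow>ws. b choose length v))"
      by (simp only: qsym_delta_M linear_map_sum[OF linear_map_tensor] tensor_eval_sum
          tensor_eval_map_tensor_ftensor[OF linear_hilbert_map] prod poly_hilbert_map_M length_map)
    also have "\<dots> = of_nat (\<Sum>k<Suc (length w). (a choose k) *
        (\<Sum>ws\<in>factorizations w k. \<Prod>v\<leftarrow>ws. b choose length v))"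
      unfolding of_nat_sum of_nat_mult sum_distrib_left
      by (intro sum.cong refl) (simp add: factorizations_def)
    also have "\<dots> = of_nat ((a * b) choose length w)"
      by (simp only: binomial_of_product[OF lessI])
    also have "\<dots> = poly (hilbert_map (M w)) (of_nat a * of_nat b)"
      using poly_hilbert_map_M[of w "a * b"] by simp
    finally show "poly (hilbert_map (M w)) (of_nat a * of_nat b) =
        tensor_eval (of_nat a) (of_nat b) (map_tensor hilbert_map (qsym_delta (M w)))" ..
  qed
  have "(\<lambda>x. poly (hilbert_map x) 1) x = qsym_eps' x"
  proof (rule linear_eqI)
    show "Vector_Spaces.linear fscale (*) (\<lambda>x. poly (hilbert_map x) 1)"
      by (rule linear_poly_comp[OF linear_hilbert_map])
    show "Vector_Spaces.linear fscale (*) qsym_eps'"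
      unfolding qsym_eps'_def by (rule linear_lin_ext[OF vector_space_mult_rat])
    show "poly (hilbert_map (M u)) 1 = qsym_eps' (M u)" for u
      using poly_hilbert_map_M[of u 1]
      by (cases "length u") (auto simp: qsym_eps'_def vector_space_mult_rat binomial_eq_0)
  qed
  then show "poly_eps' (hilbert_map x) = qsym_eps' x" by (simp add: poly_eps'_def)
qed


section \<open>Uniqueness\<close>

text \<open>
  The values at 0 are given by the counit, and the value of \<open>F (M w)\<close> at \<open>Suc n\<close> is the evaluation
  of its coproduct at the pair \<open>(n, 1)\<close>, to which the induction hypothesis and the values at 1 apply.
\<close>

lemma Delta_morphism_unique:
  assumes F: "coalgebra_morphism qsym_Delta qsym_eps poly_Delta poly_eps F"
    and G: "coalgebra_morphism qsym_Delta qsym_eps poly_Delta poly_eps G"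
    and at_1: "\<And>x. poly (F x) 1 = poly (G x) 1"
  shows "F = G"
proof
  fix x
  have lin: "Vector_Spaces.linear fscale smult F" "Vector_Spaces.linear fscale smult G"
    using F G by (simp_all add: coalgebra_morphism_def)
  have step: "poly (f (M w)) (of_nat (Suc n)) =
      (\<Sum>i\<le>length w. poly (f (M (take i w))) (of_nat n) * poly (f (M (drop i w))) 1)"
    if f: "coalgebra_morphism qsym_Delta qsym_eps poly_Delta poly_eps f" for f w n
  proof -
    have lin_f: "Vector_Spaces.linear fscale smult f"
      and "poly_Delta (f (M w)) = map_tensor f (qsym_Delta (M w))"
      using f by (simp_all add: coalgebra_morphism_def)
    then have "poly (f (M w)) (of_nat n + 1) =
        tensor_eval (of_nat n) 1 (map_tensor f (qsym_Delta (M w)))"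
      by (simp flip: tensor_eval_poly_Delta)
    then show ?thesis
      by (simp add: tensor_eval_qsym_Delta[OF lin_f] add.commute)
  qed
  have "poly (F (M w)) (of_nat n) = poly (G (M w)) (of_nat n)" for w n
  proof (induction n arbitrary: w)
    case 0
    have "poly_eps (F (M w)) = poly_eps (G (M w))"
      using F G by (simp add: coalgebra_morphism_def)
    then show ?case by (simp add: poly_eps_def)
  next
    case (Suc n)
    then show ?case by (simp only: step[OF F] step[OF G] at_1)
  qed
  then have "F (M w) = G (M w)" for w by (rule poly_eqI_nat)
  then show "F x = G x" by (rule linear_eqI[OF lin])
qed

theorem proposition3p2:
  shows "Delta_hopf_morphism hilbert_map \<and> delta_bialgebra_morphism hilbert_map \<and>
    (\<forall>F :: qsym \<Rightarrow> rat poly.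
       Delta_hopf_morphism F \<and> delta_bialgebra_morphism F \<longrightarrow> F = hilbert_map)"
proof (intro conjI allI impI)
  show H: "Delta_hopf_morphism hilbert_map"
    by (simp add: Delta_hopf_morphism_def algebra_morphism_hilbert_map
        coalgebra_morphism_Delta_hilbert_map)
  show H': "delta_bialgebra_morphism hilbert_map"
    by (simp add: delta_bialgebra_morphism_def algebra_morphism_hilbert_map
        coalgebra_morphism_delta_hilbert_map)
  fix F :: "qsym \<Rightarrow> rat poly"
  assume F: "Delta_hopf_morphism F \<and> delta_bialgebra_morphism F"
  have "poly (F x) 1 = poly (hilbert_map x) 1" for x
    using F H' by (simp add: delta_bialgebra_morphism_def coalgebra_morphism_def flip: poly_eps'_def)
  then show "F = hilbert_map"
    using F H by (intro Delta_morphism_unique) (simp_all add: Delta_hopf_morphism_def)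
qed

end
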